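(* For every $n\ge 7$ with $n\equiv 3\pmod 4$ there exists an integer cyclically $7$-diagonal globally simple $\mathrm{H}_7(n;7)$.
   Context: A partially filled (p.f.) array is a matrix in which some cells may be empty. Let $n\ge k\ge 3$, let $t$ divide $2nk$, put $v=2nk+t$ and let $J$ be the subgroup of $\mathbb{Z}_v$ of order $t$. An $\mathrm{H}_t(n;k)$ (square relative Heffter array) is an $n\times n$ p.f. array with elements in $\mathbb{Z}_v$ such that each row and each column has exactly $k$ filled cells; for every $x\in\mathbb{Z}_v\setminus J$ either $x$ or $-x$ appears in the array; and the elements of every row and column sum to $0$. It is integer if moreover the elements of every row and column, viewed as integers in $\pm\{1,\dots,\lfloor\frac{2nk+t}{2}\rfloor\}$, sum to $0$ in $\mathbb{Z}$. The natural ordering of a row (column) is the ordering of its filled cells from left to right (top to bottom). An ordering $(t_1,\dots,t_\ell)$ of elements of an abelian group is simple if its partial sums $s_i=t_1+\dots+t_i$, $1\le i\le\ell$, are pairwise distinct. The array is globally simple if the natural ordering of each row and each column is simple (partial sums computed in $\mathbb{Z}_v$). For an $n\times n$ array and $i\in\{1,\dots,n\}$, the $i$-th diagonal is $D_i=\{(i,1),(i+1,2),\dots,(i-1,n)\}$, indices taken modulo $n$ in $\{1,\dots,n\}$. Diagonals $D_i,D_{i+1},\dots,D_{i+r}$ (indices mod $n$) are consecutive. A p.f. array of size $n\ge k$ is cyclically $k$-diagonal if its nonempty cells are exactly those of $k$ consecutive diagonals. *)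

theory Defs
  imports "HOL-Number_Theory.Residues"
begin

text \<open>The elements of \<open>\<int>\<^sub>v\<close> are the residues \<open>0, \<dots>, v - 1\<close>, that is, the carrier of
  \<^term>\<open>residue_ring (int v)\<close>, so \<open>- x\<close> is \<^term>\<open>(- x) mod int v\<close>. An \<open>n \<times> n\<close> partially filled
  array is a function with row and column indices in \<open>{1..n}\<close>, where \<^const>\<open>None\<close> marks an empty
  cell; its values outside that range are irrelevant.\<close>

type_synonym pf_array = "nat \<Rightarrow> nat \<Rightarrow> int option"

definition filled_cells :: "nat \<Rightarrow> pf_array \<Rightarrow> (nat \<times> nat) set" where
  "filled_cells n A = {(i, j). i \<in> {1..n} \<and> j \<in> {1..n} \<and> A i j \<noteq> None}"

definition row_list :: "nat \<Rightarrow> pf_array \<Rightarrow> nat \<Rightarrow> int list" where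
  "row_list n A i = [the (A i j). j \<leftarrow> [1..<Suc n], A i j \<noteq> None]"

definition col_list :: "nat \<Rightarrow> pf_array \<Rightarrow> nat \<Rightarrow> int list" where
  "col_list n A j = [the (A i j). i \<leftarrow> [1..<Suc n], A i j \<noteq> None]"

definition subgroup_of_order :: "nat \<Rightarrow> nat \<Rightarrow> int set" where
  "subgroup_of_order v t =
     (THE J. subgroup J (add_monoid (residue_ring (int v))) \<and> card J = t)"

lemma subgroup_of_order_eq:
  assumes v: "1 < v" and t: "t dvd v"
  shows "subgroup_of_order v t = {x \<in> {0..<int v}. int (v div t) dvd x}" (is "_ = ?M")
    and "subgroup (subgroup_of_order v t) (add_monoid (residue_ring (int v)))"
    and "card (subgroup_of_order v t) = t"
proof -
  let ?G = "add_monoid (residue_ring (int v))"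
  define d where "d = v div t"
  have dt: "v = d * t" using t by (simp add: d_def)
  have pos: "d > 0" "t > 0" using v dt by (auto intro: Nat.gr0I)
  interpret R: residues "int v" "residue_ring (int v)"
    using v by unfold_locales auto
  have G: "group ?G" by (rule R.add.is_group)
  have M_eq: "?M = (\<lambda>i. int (d * i)) ` {0..<t}"
  proof (intro equalityI subsetI)
    fix x assume x: "x \<in> ?M"
    then obtain c where c: "x = int d * c" by (auto simp: d_def)
    from x c pos have "0 \<le> c" by (simp add: zero_le_mult_iff)
    moreover have "int d * c < int d * int t" using x c dt by simp
    hence "c < int t" using pos by simp
    ultimately show "x \<in> (\<lambda>i. int (d * i)) ` {0..<t}"
      using c by (intro image_eqI[of _ _ "nat c"]) auto
  qed (use dt pos in \<open>auto simp flip: d_def of_nat_mult\<close>)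
  have card_M: "card ?M = t" unfolding M_eq
    by (subst card_image) (use pos in \<open>auto simp: inj_on_def\<close>)
  have dv: "int (v div t) dvd int v" using dt d_def by (metis dvd_triv_left of_nat_dvd_iff)
  have sub_M: "subgroup ?M ?G"
  proof (rule group.subgroupI[OF G])
    show "?M \<subseteq> carrier ?G" by (auto simp: R.res_carrier_eq)
    show "?M \<noteq> {}" using pos card_M by (metis card.empty less_irrefl)
  next
    fix a assume a: "a \<in> ?M"
    have "inv\<^bsub>?G\<^esub> a = (- a) mod int v"
      using R.res_neg_eq[of a] by (simp add: a_inv_def)
    moreover have "(- a) mod int v \<in> ?M"
      using a v dv by (auto simp: dvd_mod)
    ultimately show "inv\<^bsub>?G\<^esub> a \<in> ?M" by (simp only:)
  next
    fix a b assume "a \<in> ?M" "b \<in> ?M"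
    then show "a \<otimes>\<^bsub>?G\<^esub> b \<in> ?M"
      using v dv by (auto simp: R.res_add_eq dvd_mod)
  qed
  have uniq: "J = ?M" if J: "subgroup J ?G" and cJ: "card J = t" for J
  proof -
    have "J \<subseteq> ?M"
    proof
      fix x assume x: "x \<in> J"
      interpret J: group "?G\<lparr>carrier := J\<rparr>"
        using group.subgroup_imp_group[OF G J] .
      have xc: "x \<in> {0..<int v}"
        using subgroup.subset[OF J] x by (auto simp: R.res_carrier_eq)
      have pw: "x [^]\<^bsub>?G\<^esub> (m::nat) = (int m * x) mod int v" for m
        by (induction m)
           (auto simp: R.res_zero_eq R.res_add_eq nat_pow_def algebra_simps mod_simps)
      have "x [^]\<^bsub>?G\<lparr>carrier := J\<rparr>\<^esub> (order (?G\<lparr>carrier := J\<rparr>)) = \<one>\<^bsub>?G\<lparr>carrier := J\<rparr>\<^esub>"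
        using x by (intro J.pow_order_eq_1) auto
      hence "x [^]\<^bsub>?G\<^esub> t = \<one>\<^bsub>?G\<^esub>"
        using cJ by (simp add: order_def nat_pow_def)
      hence "(int t * x) mod int v = 0" by (simp only: pw) (simp add: R.res_zero_eq)
      hence "int t * int d dvd int t * x" using dt by (simp add: mod_eq_0_iff_dvd mult.commute)
      hence "int d dvd x" using pos by simp
      thus "x \<in> ?M" using xc by (simp add: d_def)
    qed
    moreover have "finite ?M" by (rule finite_subset[of _ "{0..<int v}"]) auto
    ultimately show ?thesis using card_subset_eq[of ?M J] by (simp only: cJ card_M)
  qed
  show eq: "subgroup_of_order v t = ?M"
    unfolding subgroup_of_order_def
    by (rule the_equality, rule conjI[OF sub_M card_M], erule conjE, rule uniq)
  show "subgroup (subgroup_of_order v t) ?G" "card (subgroup_of_order v t) = t"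
    using sub_M card_M by (simp_all only: eq)
qed

definition heffter_array :: "nat \<Rightarrow> nat \<Rightarrow> nat \<Rightarrow> pf_array \<Rightarrow> bool" where
  "heffter_array t n k A \<longleftrightarrow>
     3 \<le> k \<and> k \<le> n \<and> t dvd 2 * n * k \<and>
     (let v = 2 * n * k + t; entries = {the (A i j) | i j. (i, j) \<in> filled_cells n A} in
        entries \<subseteq> carrier (residue_ring (int v)) \<and>
        (\<forall>i\<in>{1..n}. card {j \<in> {1..n}. A i j \<noteq> None} = k) \<and>
        (\<forall>j\<in>{1..n}. card {i \<in> {1..n}. A i j \<noteq> None} = k) \<and>
        (\<forall>x \<in> carrier (residue_ring (int v)) - subgroup_of_order v t.
            x \<in> entries \<or> (- x) mod int v \<in> entries) \<and>
        (\<forall>i\<in>{1..n}. [sum_list (row_list n A i) = 0] (mod int v)) \<and>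
        (\<forall>j\<in>{1..n}. [sum_list (col_list n A j) = 0] (mod int v)))"

text \<open>The array \<open>B\<close> below is \<open>A\<close> viewed as an array of integers. It is determined by \<open>A\<close> on the
  filled cells: a residue other than \<open>0\<close> has exactly one representative in
  \<open>\<plusminus>{1, \<dots>, \<lfloor>v/2\<rfloor>}\<close>, except for \<open>v/2\<close> when \<open>v\<close> is even, but then \<open>t\<close> is even and
  \<open>v/2\<close> lies in \<open>J\<close>; counting cells shows that no entry lies in \<open>J\<close>.\<close>

definition integer_heffter_array :: "nat \<Rightarrow> nat \<Rightarrow> nat \<Rightarrow> pf_array \<Rightarrow> bool" where
  "integer_heffter_array t n k A \<longleftrightarrow>
     heffter_array t n k A \<and>
     (let v = 2 * n * k + t in
        \<exists>B :: pf_array.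
          filled_cells n B = filled_cells n A \<and>
          (\<forall>(i, j) \<in> filled_cells n A.
             \<bar>the (B i j)\<bar> \<in> {1..int (v div 2)} \<and> [the (B i j) = the (A i j)] (mod int v)) \<and>
          (\<forall>i\<in>{1..n}. sum_list (row_list n B i) = 0) \<and>
          (\<forall>j\<in>{1..n}. sum_list (col_list n B j) = 0))"

definition simple_ordering :: "nat \<Rightarrow> int list \<Rightarrow> bool" where
  "simple_ordering v ts \<longleftrightarrow> inj_on (\<lambda>i. sum_list (take i ts) mod int v) {1..length ts}"

definition globally_simple :: "nat \<Rightarrow> nat \<Rightarrow> pf_array \<Rightarrow> bool" where
  "globally_simple v n A \<longleftrightarrow>
     (\<forall>i\<in>{1..n}. simple_ordering v (row_list n A i)) \<and>
     (\<forall>j\<in>{1..n}. simple_ordering v (col_list n A j))"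

text \<open>Reduction modulo \<open>n\<close> into \<open>{1, \<dots>, n}\<close>, for \<open>1 \<le> m\<close>.\<close>

definition wrap_index :: "nat \<Rightarrow> nat \<Rightarrow> nat" where
  "wrap_index n m = (m - 1) mod n + 1"

definition diagonal :: "nat \<Rightarrow> nat \<Rightarrow> (nat \<times> nat) set" where
  "diagonal n i = {(wrap_index n (i + s), 1 + s) | s. s < n}"

definition cyclically_diagonal :: "nat \<Rightarrow> nat \<Rightarrow> pf_array \<Rightarrow> bool" where
  "cyclically_diagonal n k A \<longleftrightarrow>
     k \<le> n \<and>
     (\<exists>i\<in>{1..n}. filled_cells n A = (\<Union>r<k. diagonal n (wrap_index n (i + r))))"

end

theory Submission
  imports Defs
begin

text \<open>Write \<open>n = 4 k - 1\<close> and \<open>v = 14 n + 7\<close>. Cell \<open>(i, i + m)\<close>, \<open>0 \<le> m \<le> 6\<close>, is filled by the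
  \<open>m\<close>-th entry of a window depending only on \<open>u = i / 2 = 2 k i\<close> modulo \<open>n\<close>, so that the entries
  of equal parity of \<open>m\<close> meet a column with consecutive values of \<open>u\<close>.

  The even positions carry four arithmetic progressions filling \<open>3 n + 2, \<dots>, 7 n + 3\<close> without the
  multiples of \<open>2 n + 1\<close>; their starting points make rows and columns cancel, wrap-around
  included. The odd positions carry \<open>z(u - 1) + (2 n + 1)\<close>, \<open>- (z(u) + z(u - 1))\<close> and
  \<open>z(u) - (2 n + 1)\<close>, whose row and column sums vanish for every \<open>n\<close>-periodic \<open>z\<close>. They fill
  \<open>1, \<dots>, 3 n + 1\<close> except \<open>2 n + 1\<close> up to sign as soon as both \<open>\<bar>z(u)\<bar>\<close> and
  \<open>\<bar>z(u) + z(u - 1)\<bar>\<close> run through \<open>1, \<dots>, n\<close>, which a zigzag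
  \<open>- n, 1, - (n - 1), 2, \<dots>\<close> whose signs are flipped from \<open>u = 2 k\<close> on achieves.

  Simplicity only depends on the size and sign of the seven entries, because for a sequence of sum
  zero it is invariant under rotation and reversal.\<close>

section \<open>Simple orderings under reduction modulo \<open>v\<close>, rotation and
  reversal\<close>

lemma sum_list_map_mod: "sum_list (map (\<lambda>x. x mod v) xs) mod v = sum_list xs mod (v :: int)"
  by (induction xs) (auto simp: mod_simps intro: mod_add_cong)

lemma simple_ordering_map_mod:
  "simple_ordering v (map (\<lambda>x. x mod int v) xs) = simple_ordering v xs"
  unfolding simple_ordering_def by (simp add: take_map sum_list_map_mod)

text \<open>Each partial sum of the rotated list is one of \<open>xs\<close> minus the moved entry
  \<open>y\<close>, and a common shift preserves distinctness modulo \<open>v\<close>.\<close>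

lemma simple_ordering_rotate1:
  assumes "simple_ordering v xs" "sum_list xs = 0"
  shows "simple_ordering v (rotate1 xs)"
proof (cases xs)
  case (Cons y ys)
  \<comment> \<open>The full rotated sum is \<open>0 = y - y\<close>, so the last index corresponds
    to the first partial sum of \<open>xs\<close>.\<close>
  define f where "f i = (if i = Suc (length ys) then 1 else Suc i)" for i
  have partial: "sum_list (take i (ys @ [y])) = sum_list (take (f i) xs) - y"
    if "i \<in> {1..Suc (length ys)}" for i
    using that assms(2) Cons by (auto simp: f_def)
  have inj_f: "inj_on f {1..Suc (length ys)}"
    by (auto simp: inj_on_def f_def split: if_splits)
  have f_range: "f i \<in> {1..length xs}" if "i \<in> {1..Suc (length ys)}" for i
    using that Cons by (auto simp: f_def)
  have "inj_on (\<lambda>i. sum_list (take i (ys @ [y])) mod int v) {1..Suc (length ys)}"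
  proof (rule inj_onI)
    fix i j assume ij: "i \<in> {1..Suc (length ys)}" "j \<in> {1..Suc (length ys)}"
      and "sum_list (take i (ys @ [y])) mod int v = sum_list (take j (ys @ [y])) mod int v"
    hence "(sum_list (take (f i) xs) - y) mod int v = (sum_list (take (f j) xs) - y) mod int v"
      by (simp only: partial)
    hence "sum_list (take (f i) xs) mod int v = sum_list (take (f j) xs) mod int v"
      by (simp add: mod_eq_dvd_iff)
    hence "f i = f j"
      using assms(1) f_range ij unfolding simple_ordering_def inj_on_def by blast
    thus "i = j" using inj_f ij by (simp add: inj_on_def)
  qed
  thus ?thesis using Cons by (simp add: simple_ordering_def)
qed (use assms in simp)

lemma sum_list_rotate1: "sum_list (rotate1 xs) = sum_list (xs :: 'a :: comm_monoid_add list)"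
  by (cases xs) (auto simp: add.commute)

lemma sum_list_rotate: "sum_list (rotate a xs) = sum_list (xs :: 'a :: comm_monoid_add list)"
  by (induction a) (auto simp: sum_list_rotate1)

lemma simple_ordering_rotate:
  assumes "simple_ordering v xs" "sum_list xs = 0"
  shows "simple_ordering v (rotate a xs)"
  using assms by (induction a) (auto simp: simple_ordering_rotate1 sum_list_rotate)

text \<open>A suffix of a zero-sum list sums to minus the complementary prefix, so reversal negates
  the partial sums and permutes their indices.\<close>

lemma simple_ordering_rev:
  assumes "simple_ordering v xs" "sum_list xs = 0"
  shows "simple_ordering v (rev xs)"
proof -
  \<comment> \<open>The last index is fixed: \<open>length xs - i\<close> would be 0 there, outside
    the range, and the full sum 0 is its own negative.\<close>
  define f where "f i = (if i = length xs then i else length xs - i)" for i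
  have partial: "sum_list (take i (rev xs)) = - sum_list (take (f i) xs)"
    if "i \<in> {1..length xs}" for i
  proof -
    have "sum_list (take (length xs - i) xs) + sum_list (drop (length xs - i) xs) = 0"
      using assms(2) by (metis append_take_drop_id sum_list_append)
    thus ?thesis using that assms(2) by (auto simp: f_def take_rev)
  qed
  have inj_f: "inj_on f {1..length xs}"
    by (auto simp: inj_on_def f_def split: if_splits)
  have f_range: "f i \<in> {1..length xs}" if "i \<in> {1..length xs}" for i
    using that by (auto simp: f_def)
  have "inj_on (\<lambda>i. sum_list (take i (rev xs)) mod int v) {1..length xs}"
  proof (rule inj_onI)
    fix i j assume ij: "i \<in> {1..length xs}" "j \<in> {1..length xs}"
      and "sum_list (take i (rev xs)) mod int v = sum_list (take j (rev xs)) mod int v"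
    hence "(- sum_list (take (f i) xs)) mod int v = (- sum_list (take (f j) xs)) mod int v"
      by (simp only: partial)
    hence "sum_list (take (f i) xs) mod int v = sum_list (take (f j) xs) mod int v"
      by (metis mod_minus_eq minus_minus)
    hence "f i = f j"
      using assms(1) f_range ij unfolding simple_ordering_def inj_on_def by blast
    thus "i = j" using inj_f ij by (simp add: inj_on_def)
  qed
  thus ?thesis by (simp add: simple_ordering_def)
qed

text \<open>The hypotheses are the size classes of the seven window positions, stated for
  independent entries so that columns, which mix different windows, are covered too.\<close>

lemma simple_ordering_window:
  fixes n :: nat and y1 p y2 q y3 r y4 :: int
  assumes "y1 + p + y2 + q + y3 + r + y4 = 0"
    and "- (4 * int n + 1) \<le> y1" "y1 \<le> - (3 * int n + 2)"
    and "int n + 1 \<le> p" "p \<le> 3 * int n + 1"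
    and "5 * int n + 3 \<le> y2" "y2 \<le> 6 * int n + 2"
    and "- int n \<le> q" "q \<le> int n" "q \<noteq> 0"
    and "4 * int n + 3 \<le> y3" "y3 \<le> 5 * int n + 2"
    and "- (3 * int n + 1) \<le> r" "r \<le> - (int n + 1)"
    and "- (7 * int n + 3) \<le> y4" "y4 \<le> - (6 * int n + 4)"
  shows "simple_ordering (2 * n * 7 + 7) [y1, p, y2, q, y3, r, y4]"
proof -
  let ?v = "14 * int n + 7"
  define s where "s i = sum_list (take i [y1, p, y2, q, y3, r, y4])" for i
  have s: "s 1 = y1" "s 2 = y1 + p" "s 3 = y1 + p + y2" "s 4 = y1 + p + y2 + q"
    "s 5 = y1 + p + y2 + q + y3" "s 6 = - y4" "s 7 = 0"
    using assms(1) by (simp_all add: s_def)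
  \<comment> \<open>the partial sums are distinct integers in an interval of length less than \<open>14 n + 7\<close>\<close>
  have chain: "s 1 < s 2" "s 2 < s 7" "s 7 < s 3" "s 7 < s 4" "s 3 < s 6" "s 4 < s 6"
    "s 6 < s 5" "s 5 < s 1 + ?v"
    unfolding s using assms by linarith+
  \<comment> \<open>The sign of \<open>q\<close> decides the order of \<open>s 3\<close> and
    \<open>s 4\<close>, so the chain does not compare them.\<close>
  have "s 3 \<noteq> s 4" unfolding s using assms(10) by simp
  have seven: "{1..7::nat} = {1, 2, 3, 4, 5, 6, 7}" by auto
  have "inj_on (\<lambda>i. s i mod ?v) {1..7}"
  proof (rule inj_onI)
    fix i j assume ij: "i \<in> {1..7}" "j \<in> {1..7}" and eq: "s i mod ?v = s j mod ?v"
    have range: "s 1 \<le> s m \<and> s m \<le> s 5" if "m \<in> {1..7}" for m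
      using that chain unfolding seven by auto
    have "\<bar>s i - s j\<bar> < ?v" using range[OF ij(1)] range[OF ij(2)] chain by linarith
    moreover have "?v dvd s i - s j" using eq by (simp only: mod_eq_dvd_iff)
    ultimately have "s i = s j" using dvd_imp_le_int[of "s i - s j" ?v] by force
    moreover have "inj_on s {1..7}"
      using chain \<open>s 3 \<noteq> s 4\<close> unfolding seven by (simp add: inj_on_insert)
    ultimately show "i = j" using ij by (simp add: inj_on_def)
  qed
  moreover have "length [y1, p, y2, q, y3, r, y4] = 7" "int (2 * n * 7 + 7) = ?v" by simp_all
  ultimately show ?thesis by (simp only: simple_ordering_def s_def)
qed

section \<open>Indices modulo \<open>n\<close> and cyclic intervals\<close>

lemma wrap_index_in: "0 < n \<Longrightarrow> wrap_index n m \<in> {1..n}"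
  by (simp add: wrap_index_def Suc_leI)

lemma wrap_index_cong: "1 \<le> m \<Longrightarrow> int (wrap_index n m) mod int n = int m mod int n"
  by (simp add: wrap_index_def of_nat_mod of_nat_diff mod_simps)

lemma wrap_index_eq_iff:
  assumes "a \<in> {1..n}" "1 \<le> m"
  shows "a = wrap_index n m \<longleftrightarrow> int a mod int n = int m mod int n"
proof
  assume "int a mod int n = int m mod int n"
  hence "int a mod int n = int (wrap_index n m) mod int n"
    using assms(2) by (simp add: wrap_index_cong)
  hence "(int a - 1) mod int n = (int (wrap_index n m) - 1) mod int n"
    by (rule mod_diff_cong) simp
  thus "a = wrap_index n m" using assms wrap_index_in[of n m] by simp
qed (use assms in \<open>simp add: wrap_index_cong\<close>)

lemma card_eq_length_filter: "card {j \<in> {1..n}. P j} = length (filter P [1..<Suc n])"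
proof -
  have "{j \<in> {1..n}. P j} = set (filter P [1..<Suc n])" by auto
  thus ?thesis by (simp only: distinct_card distinct_filter distinct_upt)
qed

lemma list_comprehension_filter: "[f x. x \<leftarrow> xs, P x] = map f (filter P xs)"
  by (induction xs) auto

lemma row_list_eq: "row_list n A i = map (\<lambda>j. the (A i j)) (filter (\<lambda>j. A i j \<noteq> None) [1..<Suc n])"
  unfolding row_list_def by (rule list_comprehension_filter)

lemma col_list_eq: "col_list n A j = map (\<lambda>i. the (A i j)) (filter (\<lambda>i. A i j \<noteq> None) [1..<Suc n])"
  unfolding col_list_def by (rule list_comprehension_filter)

lemma upt_split: "a \<le> b \<Longrightarrow> b \<le> c \<Longrightarrow> [a..<c] = [a..<b] @ [b..<c]"
  using upt_add_eq_append[of a b "c - b"] by simp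

lemma upt_0_7: "[0..<7] = [0, 1, 2, 3, 4, 5, 6]"
  by (simp add: upt_rec)

text \<open>Reading a cyclic interval by increasing index either keeps its order or puts the
  wrapped-around tail first; both are rotations. Thus the natural ordering of a row or column is a
  rotation of its cyclic order.\<close>

lemma cyclic_window_filter:
  assumes "c \<in> {1..n}" "l \<le> n" "0 < l"
  shows "\<exists>a. filter (\<lambda>j. (int j - int c) mod int n < int l) [1..<Suc n]
             = map (\<lambda>m. wrap_index n (c + m)) (rotate a [0..<l])"
proof -
  have ge: "(int j - int c) mod int n = int j - int c" if "j \<in> {c..n}" for j
    using that assms by (intro mod_pos_pos_trivial) auto
  have lt: "(int j - int c) mod int n = int j - int c + int n" if "j < c" for j
  proof -
    have "(int j - int c) mod int n = (int j - int c + int n) mod int n" by simp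
    also have "\<dots> = int j - int c + int n"
      using that assms by (intro mod_pos_pos_trivial) auto
    finally show ?thesis .
  qed
  show ?thesis
  proof (cases "c + l \<le> Suc n")
    case True
    have split: "[1..<Suc n] = [1..<c] @ [c..<c + l] @ [c + l..<Suc n]"
      using True assms upt_split[of 1 c "Suc n"] upt_split[of c "c + l" "Suc n"] by simp
    have "filter (\<lambda>j. (int j - int c) mod int n < int l) [1..<Suc n] = [c..<c + l]"
      unfolding split using assms True
      by (auto simp: filter_empty_conv filter_id_conv ge lt simp del: upt_Suc)
    also have "\<dots> = map (\<lambda>m. wrap_index n (c + m)) (rotate 0 [0..<l])"
      using assms True by (intro nth_equalityI) (auto simp: wrap_index_def simp del: upt_Suc)
    finally show ?thesis by blast
  next
    case False
    \<comment> \<open>\<open>r\<close> counts the members of the interval that wrap around to the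
      indices \<open>1\<close>, ..., \<open>r\<close>.\<close>
    define r where "r = c + l - Suc n"
    have r: "r < c" "r < l" "c + (l - r) = Suc n" "0 < r"
      using False assms by (auto simp: r_def)
    have split: "[1..<Suc n] = [1..<Suc r] @ [Suc r..<c] @ [c..<Suc n]"
      using r assms upt_split[of 1 "Suc r" "Suc n"] upt_split[of "Suc r" c "Suc n"] by simp
    have "filter (\<lambda>j. (int j - int c) mod int n < int l) [1..<Suc r] = [1..<Suc r]"
      "filter (\<lambda>j. (int j - int c) mod int n < int l) [Suc r..<c] = []"
      "filter (\<lambda>j. (int j - int c) mod int n < int l) [c..<Suc n] = [c..<Suc n]"
      using assms r by (auto simp: filter_empty_conv filter_id_conv ge lt simp del: upt_Suc)
    hence "filter (\<lambda>j. (int j - int c) mod int n < int l) [1..<Suc n] = [1..<Suc r] @ [c..<Suc n]"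
      unfolding split by (simp del: upt_Suc)
    also have "[1..<Suc r] = map (\<lambda>m. wrap_index n (c + m)) [l - r..<l]"
      using r assms by (intro nth_equalityI) (auto simp: wrap_index_def mod_if simp del: upt_Suc)
    also have "[c..<Suc n] = map (\<lambda>m. wrap_index n (c + m)) [0..<l - r]"
      using r assms by (intro nth_equalityI) (auto simp: wrap_index_def simp del: upt_Suc)
    also have "map (\<lambda>m. wrap_index n (c + m)) [l - r..<l] @ map (\<lambda>m. wrap_index n (c + m)) [0..<l - r]
      = map (\<lambda>m. wrap_index n (c + m)) (rotate (l - r) [0..<l])"
      using r by (simp add: rotate_drop_take drop_upt take_upt)
    finally show ?thesis by blast
  qed
qed

section \<open>The zigzag, the windows and the arrays\<close>

locale heffter_construction =
  fixes n :: nat and k :: int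
  assumes n_eq: "int n = 4 * k - 1" and k_ge_2: "2 \<le> k"
begin

definition zigzag :: "int \<Rightarrow> int" where
  "zigzag u =
     (let i = u mod int n;
          w = if even i then - (int n - i div 2) else (i + 1) div 2
      in if i < 2 * k then w else - w)"

definition window :: "int \<Rightarrow> int list" where
  "window u =
     [- (3 * int n + 2 + u mod int n),
      2 * int n + 1 + zigzag (u - 1),
      5 * int n + 3 + u mod int n,
      - (zigzag u + zigzag (u - 1)),
      4 * int n + 3 + (u + 2) mod int n,
      zigzag u - (2 * int n + 1),
      - (6 * int n + 4 + (u + 2) mod int n)]"

text \<open>The number of filled cells per row is 7; \<open>k\<close> only comes from
  \<open>n = 4 * k - 1\<close>, which makes \<open>2 * k\<close> the inverse of 2 modulo
  \<open>n\<close>.\<close>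

definition int_array :: pf_array where
  "int_array i j =
     (let m = (int j - int i) mod int n in
      if m < 7 then Some (window (2 * k * int i) ! nat m) else None)"

definition residue_array :: pf_array where
  "residue_array i j = map_option (\<lambda>x. x mod int (2 * n * 7 + 7)) (int_array i j)"

section \<open>Sizes of the zigzag values and of their adjacent sums\<close>

lemma n_ge_7: "7 \<le> n"
  using n_eq k_ge_2 by linarith

lemma zigzag_cong: "u mod int n = u' mod int n \<Longrightarrow> zigzag u = zigzag u'"
  by (simp add: zigzag_def)

lemma zigzag_bounds: "- int n \<le> zigzag u" "zigzag u \<le> int n" "zigzag u \<noteq> 0"
proof -
  define i where "i = u mod int n"
  have "0 \<le> i" "i < int n" using n_ge_7 by (simp_all add: i_def)
  then show "- int n \<le> zigzag u" "zigzag u \<le> int n" "zigzag u \<noteq> 0"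
    unfolding zigzag_def Let_def i_def[symmetric] using n_eq by (auto split: if_splits)
qed

text \<open>Before the sign flip adjacent terms sum to \<open>i - n\<close>, except for
  \<open>- n - 2 * k\<close> at the seam \<open>i = 0\<close>, which is too large in size. The flip
  turns the latter into \<open>1 - 2 * k\<close> and the sum at \<open>2 * k\<close> into
  \<open>n\<close>; elsewhere it changes at most signs.\<close>

lemma zigzag_sum:
  assumes "0 \<le> i" "i < int n"
  shows "zigzag i + zigzag (i - 1) =
    (if i = 0 then 1 - 2 * k else if i < 2 * k then i - int n
     else if i = 2 * k then int n else int n - i)"
proof (cases "i = 0")
  case True
  have "(-1) mod int n = int n - 1" using n_ge_7 by (simp add: zmod_minus1)
  thus ?thesis using True n_eq k_ge_2 n_ge_7 by (simp add: zigzag_def)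
next
  case False
  hence "(i - 1) mod int n = i - 1" "i mod int n = i" using assms by simp_all
  thus ?thesis using False n_eq k_ge_2 assms unfolding zigzag_def Let_def
    by (auto elim!: evenE oddE)
qed

lemma zigzag_sum_bounds:
  "- int n \<le> zigzag u + zigzag (u - 1)" "zigzag u + zigzag (u - 1) \<le> int n"
  "zigzag u + zigzag (u - 1) \<noteq> 0"
proof -
  define i where "i = u mod int n"
  have i: "0 \<le> i" "i < int n" using n_ge_7 by (simp_all add: i_def)
  have "zigzag u = zigzag i" "zigzag (u - 1) = zigzag (i - 1)"
    by (auto simp: i_def mod_simps intro: zigzag_cong)
  then show "- int n \<le> zigzag u + zigzag (u - 1)"
    "zigzag u + zigzag (u - 1) \<le> int n" "zigzag u + zigzag (u - 1) \<noteq> 0"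
    using zigzag_sum[OF i] n_eq k_ge_2 i by (auto split: if_splits)
qed

text \<open>Odd indices supply the sizes below \<open>2 * k\<close>, on either side of the sign flip
  in the first two cases; even indices supply the rest.\<close>

lemma zigzag_surj:
  assumes "1 \<le> s" "s \<le> int n"
  shows "\<exists>u. \<bar>zigzag u\<bar> = s"
proof -
  consider "s \<le> k" | "k < s" "s < 2 * k" | "2 * k \<le> s" using assms by linarith
  then show ?thesis
  proof cases
    case 1
    then show ?thesis using assms n_eq by (intro exI[of _ "2 * s - 1"]) (simp add: zigzag_def)
  next
    case 2
    then show ?thesis using assms n_eq by (intro exI[of _ "2 * s - 1"]) (simp add: zigzag_def)
  next
    case 3
    then show ?thesis using assms n_eq by (intro exI[of _ "2 * (int n - s)"]) (simp add: zigzag_def Let_def)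
  qed
qed

lemma zigzag_sum_surj:
  assumes "1 \<le> s" "s \<le> int n"
  shows "\<exists>u. \<bar>zigzag u + zigzag (u - 1)\<bar> = s"
proof -
  \<comment> \<open>Size \<open>s\<close> normally sits at index \<open>n - s\<close>; the sign flip
    interchanges the sizes at the indices 0 and \<open>2 * k\<close>, namely \<open>n\<close> and
    \<open>2 * k - 1\<close>.\<close>
  define i where "i = (if s = 2 * k - 1 then 0 else if s = int n then 2 * k else int n - s)"
  have "0 \<le> i" "i < int n" using assms n_eq k_ge_2 by (auto simp: i_def)
  from zigzag_sum[OF this] have "\<bar>zigzag i + zigzag (i - 1)\<bar> = s"
    using assms n_eq k_ge_2 by (auto simp: i_def split: if_splits)
  thus ?thesis ..
qed

section \<open>Sizes and coverage of the window entries\<close>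

lemma mod_bounds: "0 \<le> u mod int n" "u mod int n < int n"
  using n_ge_7 by simp_all

lemma window_nth:
  "window u ! 0 = - (3 * int n + 2 + u mod int n)"
  "window u ! 1 = 2 * int n + 1 + zigzag (u - 1)"
  "window u ! 2 = 5 * int n + 3 + u mod int n"
  "window u ! 3 = - (zigzag u + zigzag (u - 1))"
  "window u ! 4 = 4 * int n + 3 + (u + 2) mod int n"
  "window u ! 5 = zigzag u - (2 * int n + 1)"
  "window u ! 6 = - (6 * int n + 4 + (u + 2) mod int n)"
  by (simp_all add: window_def)

lemma window_nth_bounds:
  "- (4 * int n + 1) \<le> window u ! 0" "window u ! 0 \<le> - (3 * int n + 2)"
  "int n + 1 \<le> window u ! 1" "window u ! 1 \<le> 3 * int n + 1"
  "5 * int n + 3 \<le> window u ! 2" "window u ! 2 \<le> 6 * int n + 2"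
  "- int n \<le> window u ! 3" "window u ! 3 \<le> int n" "window u ! 3 \<noteq> 0"
  "4 * int n + 3 \<le> window u ! 4" "window u ! 4 \<le> 5 * int n + 2"
  "- (3 * int n + 1) \<le> window u ! 5" "window u ! 5 \<le> - (int n + 1)"
  "- (7 * int n + 3) \<le> window u ! 6" "window u ! 6 \<le> - (6 * int n + 4)"
  unfolding window_nth
  using zigzag_bounds(1,2)[of u] zigzag_bounds(1,2)[of "u - 1"] zigzag_sum_bounds[of u]
    mod_bounds[of u] mod_bounds[of "u + 2"]
  by linarith+

lemma length_window [simp]: "length (window u) = 7"
  by (simp add: window_def)

lemma window_cong: "u mod int n = u' mod int n \<Longrightarrow> window u = window u'"
  using zigzag_cong[of u u'] zigzag_cong[of "u - 1" "u' - 1"]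
    mod_add_cong[of u "int n" u' 2 2] mod_diff_cong[of u "int n" u' 1 1]
  by (simp add: window_def)

lemma window_abs:
  assumes "x \<in> set (window u)"
  shows "\<bar>x\<bar> \<in> {1..7 * int n + 3}"
proof -
  from assms obtain m where "m < 7" "x = window u ! m"
    by (auto simp: in_set_conv_nth)
  moreover have "m = 0 \<or> m = 1 \<or> m = 2 \<or> m = 3 \<or> m = 4 \<or> m = 5 \<or> m = 6"
    using \<open>m < 7\<close> by auto
  ultimately show ?thesis
    using window_nth_bounds[of u] by (elim disjE; simp; linarith)
qed

text \<open>Each block of sizes belongs to one window position, or to positions 1 and 5 together.
  The gaps are exactly \<open>2 * n + 1\<close>, \<open>4 * n + 2\<close> and
  \<open>6 * n + 3\<close>.\<close>

lemma window_covers: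
  assumes t: "1 \<le> t" "t \<le> 7 * int n + 3" "\<not> (2 * int n + 1) dvd t"
  shows "\<exists>u. \<exists>x \<in> set (window u). \<bar>x\<bar> = t"
proof -
  have "t \<noteq> (2 * int n + 1) * 1" "t \<noteq> (2 * int n + 1) * 2" "t \<noteq> (2 * int n + 1) * 3"
    using t(3) by (metis dvd_triv_left)+
  then consider "t \<le> int n" | "int n < t" "t \<le> 3 * int n + 1" "t \<noteq> 2 * int n + 1"
    | "3 * int n + 2 \<le> t" "t \<le> 4 * int n + 1" | "4 * int n + 3 \<le> t" "t \<le> 5 * int n + 2"
    | "5 * int n + 3 \<le> t" "t \<le> 6 * int n + 2" | "6 * int n + 4 \<le> t"
    using t(1,2) by (smt (verit))
  then show ?thesis
  proof cases
    case 1
    then obtain u where "\<bar>zigzag u + zigzag (u - 1)\<bar> = t" using zigzag_sum_surj t by blast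
    moreover have "- (zigzag u + zigzag (u - 1)) \<in> set (window u)" by (simp add: window_def)
    ultimately show ?thesis by (metis abs_minus_cancel)
  next
    case 2
    then have "1 \<le> \<bar>t - (2 * int n + 1)\<bar>" "\<bar>t - (2 * int n + 1)\<bar> \<le> int n" by linarith+
    then obtain u where u: "\<bar>zigzag u\<bar> = \<bar>t - (2 * int n + 1)\<bar>"
      using zigzag_surj by blast
    show ?thesis
    \<comment> \<open>One sign of \<open>zigzag u\<close> puts \<open>t\<close> at position 1 of the
      next window; the other puts \<open>- t\<close> at position 5 of window
      \<open>u\<close>.\<close>
    proof (cases "zigzag u = t - (2 * int n + 1)")
      case True
      then show ?thesis using 2 by (intro exI[of _ "u + 1"]) (simp add: window_def)
    next
      case False
      hence "zigzag u = 2 * int n + 1 - t" using u by linarith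
      then show ?thesis using 2 by (intro exI[of _ u]) (simp add: window_def)
    qed
  next
    case 3
    then show ?thesis
      by (intro exI[of _ "t - (3 * int n + 2)"]) (simp add: window_def)
  next
    case 4
    then show ?thesis
      by (intro exI[of _ "t - (4 * int n + 3) - 2"]) (simp add: window_def)
  next
    case 5
    then show ?thesis
      by (intro exI[of _ "t - (5 * int n + 3)"]) (simp add: window_def)
  next
    case 6
    then show ?thesis using t
      by (intro exI[of _ "t - (6 * int n + 4) - 2"]) (simp add: window_def)
  qed
qed

lemma sum_window: "sum_list (window u) = 0"
  by (simp add: window_def)

lemma simple_window_entries:
  assumes "sum_list [window u1 ! 0, window u2 ! 1, window u3 ! 2, window u4 ! 3, window u5 ! 4,
    window u6 ! 5, window u7 ! 6] = 0" (is "sum_list ?xs = 0")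
  shows "simple_ordering (2 * n * 7 + 7) ?xs"
proof (rule simple_ordering_window)
  show "window u1 ! 0 + window u2 ! 1 + window u3 ! 2 + window u4 ! 3 + window u5 ! 4
    + window u6 ! 5 + window u7 ! 6 = 0"
    using assms by simp
qed (rule window_nth_bounds)+

section \<open>Rows and columns as rotated sequences of sum zero\<close>

lemma int_array_eq_None_iff: "int_array i j = None \<longleftrightarrow> \<not> (int j - int i) mod int n < 7"
  by (simp add: int_array_def Let_def)

lemma residue_array_eq_None_iff: "residue_array i j = None \<longleftrightarrow> int_array i j = None"
  by (simp add: residue_array_def)

lemma the_residue_array:
  "int_array i j \<noteq> None \<Longrightarrow> the (residue_array i j) = the (int_array i j) mod int (2 * n * 7 + 7)"
  by (auto simp: residue_array_def)

lemma row_list_residue: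
  "row_list n residue_array i = map (\<lambda>x. x mod int (2 * n * 7 + 7)) (row_list n int_array i)"
  by (simp add: row_list_eq residue_array_eq_None_iff the_residue_array del: upt_Suc)

lemma col_list_residue:
  "col_list n residue_array j = map (\<lambda>x. x mod int (2 * n * 7 + 7)) (col_list n int_array j)"
  by (simp add: col_list_eq residue_array_eq_None_iff the_residue_array del: upt_Suc)

lemma int_array_row_entry:
  assumes "1 \<le> i" "m < 7"
  shows "int_array i (wrap_index n (i + m)) = Some (window (2 * k * int i) ! m)"
proof -
  have "(int (wrap_index n (i + m)) - int i) mod int n = (int (i + m) - int i) mod int n"
    using assms by (intro mod_diff_cong wrap_index_cong) auto
  also have "\<dots> = int m" using assms n_ge_7 by simp
  finally show ?thesis using assms by (simp add: int_array_def)
qed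

text \<open>Descending a column lowers the offset \<open>j - i\<close>, so the window positions run
  from 6 down to 0, starting in the row congruent to \<open>j - 6\<close>.\<close>

lemma int_array_col_entry:
  assumes "1 \<le> c" "int c mod int n = (int j - 6) mod int n" "m < 7"
  shows "int_array (wrap_index n (c + m)) j = Some (window (2 * k * (int j - int (6 - m))) ! (6 - m))"
proof -
  let ?i = "wrap_index n (c + m)"
  have "int ?i mod int n = (int c + int m) mod int n"
    using assms by (simp add: wrap_index_cong)
  also have "\<dots> = (int j - 6 + int m) mod int n"
    using assms(2) by (rule mod_add_cong) simp
  finally have i: "int ?i mod int n = (int j - int (6 - m)) mod int n"
    using assms(3) by (simp add: of_nat_diff algebra_simps)
  have "(int j - int ?i) mod int n = (int j - (int j - int (6 - m))) mod int n"
    using i by (intro mod_diff_cong) auto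
  also have "\<dots> = int (6 - m)" using assms n_ge_7 by simp
  finally have "int_array ?i j = Some (window (2 * k * int ?i) ! (6 - m))"
    by (simp add: int_array_def)
  also have "window (2 * k * int ?i) = window (2 * k * (int j - int (6 - m)))"
    using i by (intro window_cong mod_mult_cong) auto
  finally show ?thesis .
qed

lemma row_list_int_array:
  assumes "i \<in> {1..n}"
  shows "\<exists>a. row_list n int_array i = rotate a (window (2 * k * int i))"
proof -
  obtain a where "filter (\<lambda>j. (int j - int i) mod int n < 7) [1..<Suc n]
      = map (\<lambda>m. wrap_index n (i + m)) (rotate a [0..<7])"
    using cyclic_window_filter[OF assms, of 7] n_ge_7 by auto
  hence "row_list n int_array i
      = map (\<lambda>m. the (int_array i (wrap_index n (i + m)))) (rotate a [0..<7])"
    by (simp add: row_list_eq int_array_eq_None_iff del: upt_Suc)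
  also have "\<dots> = map (\<lambda>m. window (2 * k * int i) ! m) (rotate a [0..<7])"
    using assms by (intro map_cong) (auto simp: int_array_row_entry)
  also have "\<dots> = rotate a (window (2 * k * int i))"
    using map_nth[of "window (2 * k * int i)"] by (simp only: rotate_map[symmetric] length_window)
  finally show ?thesis ..
qed

text \<open>Indexed by window position, this lists a column cyclically upwards: position
  \<open>m\<close> comes from row \<open>j - m\<close>.\<close>

definition col_window :: "int \<Rightarrow> int list" where
  "col_window j = map (\<lambda>m. window (2 * k * (j - int m)) ! m) [0..<7]"

lemma col_list_int_array:
  assumes "j \<in> {1..n}"
  shows "\<exists>a. col_list n int_array j = rotate a (rev (col_window (int j)))"
proof -
  \<comment> \<open>This represents \<open>j - 6\<close>; \<open>n\<close> is added because natural
    subtraction truncates.\<close>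
  define c where "c = wrap_index n (j + (n - 6))"
  have c: "c \<in> {1..n}" using n_ge_7 by (simp only: c_def) (rule wrap_index_in, simp)
  have "int c mod int n = (int j + int n - 6) mod int n"
    using assms n_ge_7 by (simp add: c_def wrap_index_cong of_nat_diff algebra_simps)
  also have "\<dots> = (int j - 6) mod int n"
    using mod_add_self2[of "int j - 6" "int n"] by (simp add: algebra_simps)
  finally have cj: "int c mod int n = (int j - 6) mod int n" .
  \<comment> \<open>The reflection \<open>6 - x\<close> preserves the residues 0 to 6. Being an
    involution, it yields an equivalence of the two filter conditions.\<close>
  have small: "(6 - x) mod int n < 7" if "x mod int n < 7" for x
  proof -
    have "(6 - x) mod int n = (6 - x mod int n) mod int n" by (simp add: mod_simps)
    also have "\<dots> = 6 - x mod int n"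
      using that mod_bounds[of x] n_ge_7 by (intro mod_pos_pos_trivial) linarith+
    finally show ?thesis using mod_bounds[of x] by linarith
  qed
  have shift: "(int i - int c) mod int n = (6 - (int j - int i)) mod int n" for i
  proof -
    have "(int i - int c) mod int n = (int i - (int j - 6)) mod int n"
      using cj by (intro mod_diff_cong) auto
    thus ?thesis by (simp add: algebra_simps)
  qed
  have "(int j - int i) mod int n < 7 \<longleftrightarrow> (int i - int c) mod int n < 7" for i
    using small[of "int j - int i"] small[of "6 - (int j - int i)"] unfolding shift by auto
  moreover obtain a where "filter (\<lambda>i. (int i - int c) mod int n < 7) [1..<Suc n]
      = map (\<lambda>m. wrap_index n (c + m)) (rotate a [0..<7])"
    using cyclic_window_filter[OF c, of 7] n_ge_7 by auto
  ultimately have "col_list n int_array j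
      = map (\<lambda>m. the (int_array (wrap_index n (c + m)) j)) (rotate a [0..<7])"
    by (simp add: col_list_eq int_array_eq_None_iff del: upt_Suc)
  also have "\<dots> = map (\<lambda>m. window (2 * k * (int j - int (6 - m))) ! (6 - m)) (rotate a [0..<7])"
    using c cj by (intro map_cong) (auto simp: int_array_col_entry)
  also have "\<dots> = rotate a (map (\<lambda>m. window (2 * k * (int j - int (6 - m))) ! (6 - m)) [0..<7])"
    by (rule rotate_map[symmetric])
  also have "map (\<lambda>m. window (2 * k * (int j - int (6 - m))) ! (6 - m)) [0..<7]
      = rev (col_window (int j))"
    by (simp add: col_window_def upt_0_7)
  finally show ?thesis ..
qed

text \<open>Two rows change the argument \<open>2 * k * i\<close> by \<open>4 * k = n + 1\<close>,
  hence by 1 modulo \<open>n\<close>.\<close>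

lemma col_window_eq:
  "col_window j = [window (2 * k * j) ! 0, window (2 * k * (j - 1)) ! 1, window (2 * k * j - 1) ! 2,
    window (2 * k * (j - 1) - 1) ! 3, window (2 * k * j - 2) ! 4, window (2 * k * (j - 1) - 2) ! 5,
    window (2 * k * j - 3) ! 6]"
proof -
  have shift: "window (2 * k * (j - 2 * b - c)) = window (2 * k * (j - c) - b)" for b c
  proof (rule window_cong)
    have "2 * k * (j - 2 * b - c) = 2 * k * (j - c) - b - int n * b"
      by (simp add: n_eq algebra_simps)
    thus "2 * k * (j - 2 * b - c) mod int n = (2 * k * (j - c) - b) mod int n"
      by (metis mod_diff_right_eq mod_mult_self1_is_0 diff_zero)
  qed
  show ?thesis
    using shift[of 1 0] shift[of 1 1] shift[of 2 0] shift[of 2 1] shift[of 3 0]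
    by (simp add: col_window_def upt_0_7)
qed

text \<open>With \<open>u = 2 * k * j\<close>, the shift by 2 in positions 4 and 6 makes the
  residues of \<open>u\<close> and \<open>u - 1\<close> each appear once with either sign, so
  wrap-around needs no correction. The zigzag values at the odd positions cancel in pairs.\<close>

lemma sum_col_window: "sum_list (col_window j) = 0"
  by (simp add: col_window_eq window_nth del: One_nat_def)

lemma sum_row_list: "i \<in> {1..n} \<Longrightarrow> sum_list (row_list n int_array i) = 0"
  using row_list_int_array[of i] sum_window by (auto simp: sum_list_rotate)

lemma sum_col_list: "j \<in> {1..n} \<Longrightarrow> sum_list (col_list n int_array j) = 0"
  using col_list_int_array[of j] sum_col_window by (auto simp: sum_list_rotate sum_list_rev)

lemma window_eq: "window u = [window u ! 0, window u ! 1, window u ! 2, window u ! 3, window u ! 4,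
    window u ! 5, window u ! 6]"
  by (simp add: window_def)

lemma globally_simple_residue_array: "globally_simple (2 * n * 7 + 7) n residue_array"
  unfolding globally_simple_def
proof (intro conjI ballI)
  fix i assume "i \<in> {1..n}"
  then obtain a where "row_list n int_array i = rotate a (window (2 * k * int i))"
    using row_list_int_array by blast
  moreover have "simple_ordering (2 * n * 7 + 7) (window u)" for u
    using simple_window_entries[of u u u u u u u] sum_window[of u] unfolding window_eq[symmetric] by blast
  ultimately show "simple_ordering (2 * n * 7 + 7) (row_list n residue_array i)"
    by (simp only: row_list_residue simple_ordering_map_mod simple_ordering_rotate sum_window)
next
  fix j assume "j \<in> {1..n}"
  then obtain a where "col_list n int_array j = rotate a (rev (col_window (int j)))"
    using col_list_int_array by blast
  moreover have "simple_ordering (2 * n * 7 + 7) (col_window (int j))"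
    using sum_col_window[of "int j"] unfolding col_window_eq by (rule simple_window_entries)
  ultimately show "simple_ordering (2 * n * 7 + 7) (col_list n residue_array j)"
    by (simp only: col_list_residue simple_ordering_map_mod simple_ordering_rotate
        simple_ordering_rev sum_list_rev sum_col_window)
qed

section \<open>The seven consecutive diagonals\<close>

lemma filled_cells_residue: "filled_cells n residue_array = filled_cells n int_array"
  by (simp add: filled_cells_def residue_array_eq_None_iff)

text \<open>A cell of offset \<open>m\<close> lies on diagonal \<open>1 - m\<close> modulo
  \<open>n\<close>, so the offsets 6 down to 0 give the diagonals from \<open>n - 5\<close> through
  \<open>n\<close> to 1.\<close>

lemma cyclically_diagonal_residue_array: "cyclically_diagonal n 7 residue_array"
proof -
  have "(a, b) \<in> filled_cells n residue_array \<longleftrightarrow>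
      (\<exists>r<7. (a, b) \<in> diagonal n (wrap_index n (n - 5 + r)))" for a b
  proof (cases "a \<in> {1..n} \<and> b \<in> {1..n}")
    case True
    have wrap: "wrap_index n (wrap_index n (n - 5 + r) + s) = wrap_index n (n - 5 + r + s)" for r s
      using n_ge_7 by (simp add: wrap_index_def mod_simps)
    have "(a, b) \<in> diagonal n (wrap_index n (n - 5 + r)) \<longleftrightarrow> (int b - int a) mod int n = 6 - int r"
      if "r < 7" for r
    proof -
      have "(a, b) \<in> diagonal n (wrap_index n (n - 5 + r)) \<longleftrightarrow>
          a = wrap_index n (n - 5 + r + (b - 1))"
        using True by (auto simp: diagonal_def wrap intro!: exI[of _ "b - 1"])
      also have "\<dots> \<longleftrightarrow> int a mod int n = int (n - 5 + r + (b - 1)) mod int n"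
        using True n_ge_7 by (intro wrap_index_eq_iff) auto
      also have "int (n - 5 + r + (b - 1)) = int b - (6 - int r) + int n"
        using True n_ge_7 by (simp add: of_nat_diff)
      also have "int a mod int n = (int b - (6 - int r) + int n) mod int n \<longleftrightarrow>
          (int b - int a) mod int n = (6 - int r) mod int n"
        unfolding mod_add_self2 mod_eq_dvd_iff by (subst dvd_diff_commute) (simp add: algebra_simps)
      also have "(6 - int r) mod int n = 6 - int r"
        using that n_ge_7 by (intro mod_pos_pos_trivial) auto
      finally show ?thesis .
    qed
    moreover have "(int b - int a) mod int n < 7 \<longleftrightarrow> (\<exists>r<7. (int b - int a) mod int n = 6 - int r)"
    proof
      assume "(int b - int a) mod int n < 7"
      thus "\<exists>r<7. (int b - int a) mod int n = 6 - int r"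
        using mod_bounds[of "int b - int a"]
        by (intro exI[of _ "nat (6 - (int b - int a) mod int n)"]) simp
    qed auto
    moreover have "(a, b) \<in> filled_cells n residue_array \<longleftrightarrow> (int b - int a) mod int n < 7"
      using True by (auto simp: filled_cells_def residue_array_eq_None_iff int_array_eq_None_iff)
    ultimately show ?thesis by blast
  next
    case False
    then show ?thesis
      using n_ge_7 wrap_index_in[of n] by (auto simp: filled_cells_def diagonal_def)
  qed
  hence "filled_cells n residue_array = (\<Union>r<7. diagonal n (wrap_index n (n - 5 + r)))"
    by (auto simp only: set_eq_iff split_paired_All UN_iff lessThan_iff)
  moreover have "n - 5 \<in> {1..n}" using n_ge_7 by auto
  ultimately show ?thesis unfolding cyclically_diagonal_def using n_ge_7 by blast
qed

section \<open>The Heffter conditions and integrality\<close>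

lemma window_in_residue_array:
  assumes "x \<in> set (window u)"
  shows "\<exists>i j. (i, j) \<in> filled_cells n residue_array \<and>
    the (residue_array i j) = x mod int (2 * n * 7 + 7)"
proof -
  obtain m where m: "m < 7" "x = window u ! m"
    using assms by (auto simp: in_set_conv_nth)
  \<comment> \<open>Row \<open>2 * u\<close> carries window \<open>u\<close>, as
    \<open>2 * k\<close> inverts 2 modulo \<open>n\<close>; adding \<open>n\<close> keeps the
    argument of \<open>wrap_index\<close> positive.\<close>
  define i where "i = wrap_index n (nat (2 * u mod int n) + n)"
  have i: "i \<in> {1..n}" using n_ge_7 by (simp only: i_def) (rule wrap_index_in, simp)
  have "int i mod int n = 2 * u mod int n"
    using n_ge_7 by (simp add: i_def wrap_index_cong mod_simps)
  hence "2 * k * int i mod int n = 2 * k * (2 * u) mod int n"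
    by (intro mod_mult_cong) auto
  also have "2 * k * (2 * u) = u + int n * u" by (simp add: n_eq algebra_simps)
  finally have "window (2 * k * int i) = window u"
    by (intro window_cong) simp
  with i m have entry: "int_array i (wrap_index n (i + m)) = Some x"
    by (simp add: int_array_row_entry)
  moreover have "wrap_index n (i + m) \<in> {1..n}" using n_ge_7 by (intro wrap_index_in) simp
  ultimately have "(i, wrap_index n (i + m)) \<in> filled_cells n residue_array"
    using i by (simp add: filled_cells_def residue_array_eq_None_iff)
  moreover have "the (residue_array i (wrap_index n (i + m))) = x mod int (2 * n * 7 + 7)"
    using entry by (simp add: the_residue_array)
  ultimately show ?thesis by blast
qed

lemma residue_array_covers:
  assumes x: "x \<in> {0..<int (2 * n * 7 + 7)}" "\<not> (2 * int n + 1) dvd x"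
  shows "\<exists>i j. (i, j) \<in> filled_cells n residue_array \<and>
    (the (residue_array i j) = x \<or> the (residue_array i j) = (- x) mod int (2 * n * 7 + 7))"
proof -
  let ?v = "int (2 * n * 7 + 7)"
  \<comment> \<open>\<open>t\<close> is the least absolute value of an integer congruent to
    \<open>x\<close>. Divisibility by \<open>2 * n + 1\<close> survives the passage to
    \<open>t\<close> because \<open>2 * n + 1\<close> divides \<open>?v\<close>.\<close>
  define t where "t = (if x \<le> 7 * int n + 3 then x else ?v - x)"
  have "?v = (2 * int n + 1) * 7" by simp
  hence dvd_v: "(2 * int n + 1) dvd ?v" by (metis dvd_triv_left)
  have "\<not> (2 * int n + 1) dvd t"
    using x(2) by (simp only: t_def dvd_diff_right_iff[OF dvd_v] split: if_split) simp
  moreover have "x \<noteq> 0" using x(2) by auto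
  ultimately obtain u y where y: "y \<in> set (window u)" "\<bar>y\<bar> = t"
    using window_covers[of t] x(1) by (auto simp: t_def split: if_splits)
  have "t mod ?v = x \<and> (- t) mod ?v = (- x) mod ?v \<or> t mod ?v = (- x) mod ?v \<and> (- t) mod ?v = x"
  proof (cases "x \<le> 7 * int n + 3")
    case True
    then show ?thesis using x(1) by (simp add: t_def)
  next
    case False
    have "(?v - x) mod ?v = (- x) mod ?v" "(- (?v - x)) mod ?v = x mod ?v"
      by (metis mod_add_self1 add_uminus_conv_diff, metis minus_diff_eq minus_mod_self2)
    then show ?thesis using False x(1) by (simp only: t_def if_False) auto
  qed
  moreover have "y = t \<or> y = - t" using y(2) by auto
  ultimately have "y mod ?v = x \<or> y mod ?v = (- x) mod ?v" by auto
  with window_in_residue_array[OF y(1)] show ?thesis by metis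
qed

lemma int_array_bounds:
  assumes "(i, j) \<in> filled_cells n int_array"
  shows "\<bar>the (int_array i j)\<bar> \<in> {1..7 * int n + 3}"
proof -
  have "(int j - int i) mod int n < 7"
    using assms by (auto simp: filled_cells_def int_array_eq_None_iff)
  hence "the (int_array i j) \<in> set (window (2 * k * int i))"
    using mod_bounds[of "int j - int i"] by (auto simp: int_array_def Let_def intro!: nth_mem)
  thus ?thesis by (rule window_abs)
qed

text \<open>The residues exempted in \<open>residue_array_covers\<close> are the multiples of
  \<open>2 * n + 1\<close>, a seventh of the modulus, and these form the subgroup of order
  7.\<close>

lemma heffter_residue_array: "heffter_array 7 n 7 residue_array"
proof -
  let ?v = "2 * n * 7 + 7"
  have J: "subgroup_of_order ?v 7 = {x \<in> {0..<int ?v}. int (?v div 7) dvd x}"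
    by (rule subgroup_of_order_eq) simp_all
  have carrier: "carrier (residue_ring (int ?v)) = {0..<int ?v}"
    by (auto simp: residue_ring_def)
  have div7: "int (?v div 7) = 2 * int n + 1" by simp
  \<comment> \<open>Cells are counted through list lengths: each row or column is a rotation of a
    list of length 7.\<close>
  have row_card: "card {j \<in> {1..n}. residue_array i j \<noteq> None} = 7" if i: "i \<in> {1..n}" for i
  proof -
    have "length (row_list n residue_array i) = 7"
      using row_list_int_array[OF i] by (auto simp: row_list_residue)
    thus ?thesis by (simp only: card_eq_length_filter row_list_eq length_map)
  qed
  have col_card: "card {i \<in> {1..n}. residue_array i j \<noteq> None} = 7" if j: "j \<in> {1..n}" for j
  proof -
    have "length (col_list n residue_array j) = 7"
      using col_list_int_array[OF j] by (auto simp: col_list_residue col_window_def)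
    thus ?thesis by (simp only: card_eq_length_filter col_list_eq length_map)
  qed
  have row_sum: "[sum_list (row_list n residue_array i) = 0] (mod int ?v)" if "i \<in> {1..n}" for i
    using sum_row_list[OF that] unfolding cong_def row_list_residue sum_list_map_mod by simp
  have col_sum: "[sum_list (col_list n residue_array j) = 0] (mod int ?v)" if "j \<in> {1..n}" for j
    using sum_col_list[OF that] unfolding cong_def col_list_residue sum_list_map_mod by simp
  have range: "the (residue_array i j) \<in> {0..<int ?v}" if "(i, j) \<in> filled_cells n residue_array" for i j
  proof -
    have "int_array i j \<noteq> None" using that by (simp add: filled_cells_def residue_array_eq_None_iff)
    thus ?thesis by (simp add: the_residue_array del: of_nat_add of_nat_mult)
  qed
  show ?thesis
    unfolding heffter_array_def Let_def J carrier div7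
  proof (intro conjI ballI)
    fix x assume "x \<in> {0..<int ?v} - {x \<in> {0..<int ?v}. 2 * int n + 1 dvd x}"
    hence "x \<in> {0..<int ?v}" "\<not> 2 * int n + 1 dvd x" by blast+
    from residue_array_covers[OF this]
    show "x \<in> {the (residue_array i j) |i j. (i, j) \<in> filled_cells n residue_array} \<or>
        - x mod int ?v \<in> {the (residue_array i j) |i j. (i, j) \<in> filled_cells n residue_array}"
      by (smt (verit) mem_Collect_eq)
  qed (use n_ge_7 range row_card col_card row_sum col_sum in blast | use n_ge_7 in simp)+
qed

text \<open>\<open>int_array\<close> is the integer lift; its bound \<open>7 * n + 3\<close> is half
  the modulus rounded down.\<close>

lemma integer_heffter_residue_array: "integer_heffter_array 7 n 7 residue_array"
proof -
  let ?v = "2 * n * 7 + 7"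
  have half: "int (?v div 2) = 7 * int n + 3" by simp
  have "[the (int_array i j) = the (residue_array i j)] (mod int ?v)"
    if "(i, j) \<in> filled_cells n int_array" for i j
    using that by (simp add: filled_cells_def the_residue_array cong_def del: of_nat_add of_nat_mult)
  thus ?thesis
    unfolding integer_heffter_array_def Let_def filled_cells_residue half
    using heffter_residue_array int_array_bounds sum_row_list sum_col_list
    by (intro conjI exI[of _ int_array]) auto
qed

end

theorem proposition4p6:
  fixes n :: nat
  assumes "7 \<le> n" and "[n = 3] (mod 4)"
  shows "\<exists>A. integer_heffter_array 7 n 7 A \<and> cyclically_diagonal n 7 A \<and>
             globally_simple (2 * n * 7 + 7) n A"
proof -
  have "n mod 4 = 3" using assms(2) by (simp add: cong_def)
  hence "n = 4 * (n div 4) + 3" by presburger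
  then obtain q where "n = 4 * q + 3" by blast
  \<comment> \<open>Here \<open>4 * q + 3 = 4 * (q + 1) - 1\<close>, and \<open>7 \<le> n\<close>
    forces \<open>q + 1\<close> to be at least 2.\<close>
  then interpret heffter_construction n "int q + 1"
    using assms(1) by unfold_locales auto
  show ?thesis
    using integer_heffter_residue_array cyclically_diagonal_residue_array
      globally_simple_residue_array by blast
qed

end
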